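(* Let $\mathcal{R}$ be a $\ast$-ring and let $a\in\mathcal{R}$. Then the following are equivalent: (i) $a$ is right pseudo core invertible; (ii) $a^{k+1}ya^k=a^k$ and $(a^{k+1}y)^\ast=a^{k+1}y$ for some $y\in\mathcal{R}$ and some positive integer $k$; (iii) $a^{k}\in\mathcal{R}^{\{1,3\}}$ and $a^{k}\mathcal{R}=a^{k+1}\mathcal{R}$ for some positive integer $k$; (iv) $a^{k+1}x^{k+1}a^{k}=a^k$, $ax^{2}=x$ and $(a^{k+1}x^{k+1})^\ast=a^{k+1}x^{k+1}$ for some $x\in\mathcal{R}$ and some positive integer $k$.
   Context: A $\ast$-ring is an associative ring $\mathcal{R}$ with identity $1$ equipped with an involution, i.e. a map $\ast:\mathcal{R}\to\mathcal{R}$ with $(a^\ast)^\ast=a$, $(a+b)^\ast=a^\ast+b^\ast$, $(ab)^\ast=b^\ast a^\ast$ for all $a,b\in\mathcal{R}$. $\mathcal{R}^{\{1,3\}}$ is the set of $a\in\mathcal{R}$ for which there is $x\in\mathcal{R}$ with $axa=a$ and $(ax)^\ast=ax$. An element $a\in\mathcal{R}$ is right pseudo core invertible if there exist $x\in\mathcal{R}$ and a positive integer $k$ such that $axa^k=a^k$, $x=ax^2$ and $(ax)^\ast=ax$; any such $x$ is called a right pseudo core inverse of $a$. *)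

theory Defs
  imports Main
begin

text \<open>
  The class is built on \<^class>\<open>ring\<close> and \<^class>\<open>monoid_mult\<close> rather than on \<^class>\<open>ring_1\<close>,
  since the latter requires \<open>0 \<noteq> 1\<close> and would exclude the zero ring.
\<close>

class star_ring = ring + monoid_mult +
  fixes star :: "'a \<Rightarrow> 'a"
  assumes star_star: "star (star a) = a"
    and star_add: "star (a + b) = star a + star b"
    and star_mult: "star (a * b) = star b * star a"

text \<open>The set written \<open>R\<close> with superscript \<open>{1,3}\<close>.\<close>

definition one_three_invertibles :: "'a::star_ring set" where
  "one_three_invertibles = {a. \<exists>x. a * x * a = a \<and> star (a * x) = a * x}"

definition is_right_pseudo_core_inverse :: "'a::star_ring \<Rightarrow> 'a \<Rightarrow> bool" where
  "is_right_pseudo_core_inverse a x \<longleftrightarrow>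
     (\<exists>k::nat. k > 0 \<and> a * x * a ^ k = a ^ k \<and> x = a * x ^ 2 \<and> star (a * x) = a * x)"

definition right_pseudo_core_invertible :: "'a::star_ring \<Rightarrow> bool" where
  "right_pseudo_core_invertible a \<longleftrightarrow> (\<exists>x. is_right_pseudo_core_inverse a x)"

definition right_multiples :: "'a::star_ring \<Rightarrow> 'a set" where
  "right_multiples a = {a * r |r. True}"

end

theory Submission
  imports Defs
begin

text \<open>All four conditions describe one self-adjoint element \<open>p\<close> of
  \<open>a ^ k * R\<close> with \<open>p * a ^ k = a ^ k\<close>. In (i) it is \<open>a * x\<close>.
  Since \<open>a * x ^ 2 = x\<close> makes \<open>a ^ Suc n * x ^ Suc n\<close> telescope to
  \<open>a * x\<close>, (iv) is (i) rewritten, and (ii) keeps from (iv) only that \<open>p\<close>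
  lies in \<open>a ^ (k + 1) * R\<close>. Splitting off one factor \<open>a\<close> from
  \<open>p\<close> gives (iii). The substantial step is (iii) to (i), where
  \<open>is_right_pseudo_core_inverseI\<close> builds the inverse explicitly.\<close>

lemma power_Suc_mult_power_Suc_if_mult_square_eq:
  fixes a x :: "'a::monoid_mult"
  assumes "a * x ^ 2 = x"
  shows "a ^ Suc n * x ^ Suc n = a * x"
proof (induction n)
  case (Suc n)
  \<comment> \<open>The innermost block \<open>a * x ^ 2\<close> collapses to \<open>x\<close>,
    removing one factor on each side.\<close>
  have "a ^ Suc (Suc n) * x ^ Suc (Suc n) = a ^ Suc n * (a * x ^ 2) * x ^ n"
    by (simp only: power_Suc2 [of a "Suc n"] power_Suc [of x] power2_eq_square mult.assoc)
  also have "\<dots> = a ^ Suc n * x ^ Suc n"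
    by (simp add: assms mult.assoc)
  finally show ?case
    using Suc by simp
qed simp

text \<open>Only the inclusion of the ideal of \<open>a ^ k\<close> in that of
  \<open>a ^ Suc k\<close> has content, and it can be tested on the generator
  \<open>a ^ k\<close>.\<close>

lemma right_multiples_power_Suc_eq_iff:
  fixes a :: "'a::star_ring"
  shows "right_multiples (a ^ k) = right_multiples (a ^ Suc k) \<longleftrightarrow> (\<exists>r. a ^ k = a ^ Suc k * r)"
proof
  assume "right_multiples (a ^ k) = right_multiples (a ^ Suc k)"
  moreover have "a ^ k * 1 \<in> right_multiples (a ^ k)"
    unfolding right_multiples_def by blast
  ultimately show "\<exists>r. a ^ k = a ^ Suc k * r"
    by (auto simp: right_multiples_def)
next
  assume "\<exists>r. a ^ k = a ^ Suc k * r"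
  then obtain r where r: "a ^ k = a ^ Suc k * r" ..
  have "a ^ k * s = a ^ Suc k * (r * s)" for s
    by (subst r) (simp only: mult.assoc)
  moreover have "a ^ Suc k * s = a ^ k * (a * s)" for s
    by (simp only: power_Suc2 mult.assoc)
  ultimately show "right_multiples (a ^ k) = right_multiples (a ^ Suc k)"
    unfolding right_multiples_def by blast
qed

text \<open>The witness is chosen so that multiplying it by \<open>a\<close> on the left lets
  \<open>r\<close> absorb the extra factor, leaving the self-adjoint \<open>a ^ k * z\<close>. This
  fixes \<open>a ^ k\<close>, hence also the witness, which starts with
  \<open>a ^ k\<close>.\<close>

lemma is_right_pseudo_core_inverseI:
  fixes a :: "'a::star_ring"
  assumes "k > 0" and z: "a ^ k * z * a ^ k = a ^ k" "star (a ^ k * z) = a ^ k * z"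
    and r: "a ^ k = a ^ Suc k * r"
  shows "is_right_pseudo_core_inverse a (a ^ k * r * z)"
proof -
  have ax: "a * (a ^ k * r * z) = a ^ k * z"
    by (subst (2) r) (simp add: mult.assoc)
  have "a * (a ^ k * r * z) ^ 2 = (a * (a ^ k * r * z)) * (a ^ k * r * z)"
    by (simp add: power2_eq_square mult.assoc)
  also have "\<dots> = (a ^ k * z * a ^ k) * r * z"
    by (simp only: ax) (simp only: mult.assoc)
  finally have "a * (a ^ k * r * z) ^ 2 = a ^ k * r * z"
    by (simp add: z)
  then show ?thesis
    unfolding is_right_pseudo_core_inverse_def using \<open>k > 0\<close> z ax by metis
qed

theorem theorem4p9:
  fixes a :: "'a::star_ring"
  shows
    "(right_pseudo_core_invertible a \<longleftrightarrow>
       (\<exists>y. \<exists>k::nat. k > 0 \<and> a ^ (k + 1) * y * a ^ k = a ^ k \<and>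
          star (a ^ (k + 1) * y) = a ^ (k + 1) * y)) \<and>
     (right_pseudo_core_invertible a \<longleftrightarrow>
       (\<exists>k::nat. k > 0 \<and> a ^ k \<in> one_three_invertibles \<and>
          right_multiples (a ^ k) = right_multiples (a ^ (k + 1)))) \<and>
     (right_pseudo_core_invertible a \<longleftrightarrow>
       (\<exists>x. \<exists>k::nat. k > 0 \<and> a ^ (k + 1) * x ^ (k + 1) * a ^ k = a ^ k \<and> a * x ^ 2 = x \<and>
          star (a ^ (k + 1) * x ^ (k + 1)) = a ^ (k + 1) * x ^ (k + 1)))"
proof -
  let ?ii = "\<exists>y. \<exists>k::nat. k > 0 \<and> a ^ (k + 1) * y * a ^ k = a ^ k \<and>
    star (a ^ (k + 1) * y) = a ^ (k + 1) * y"
  let ?iii = "\<exists>k::nat. k > 0 \<and> a ^ k \<in> one_three_invertibles \<and>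
    right_multiples (a ^ k) = right_multiples (a ^ (k + 1))"
  let ?iv = "\<exists>x. \<exists>k::nat. k > 0 \<and> a ^ (k + 1) * x ^ (k + 1) * a ^ k = a ^ k \<and> a * x ^ 2 = x \<and>
    star (a ^ (k + 1) * x ^ (k + 1)) = a ^ (k + 1) * x ^ (k + 1)"
  have i_iv: "right_pseudo_core_invertible a \<longleftrightarrow> ?iv"
    unfolding right_pseudo_core_invertible_def is_right_pseudo_core_inverse_def Suc_eq_plus1 [symmetric]
    by (metis power_Suc_mult_power_Suc_if_mult_square_eq)
  \<comment> \<open>Take \<open>y = x ^ (k + 1)\<close>.\<close>
  have iv_ii: "?iv \<Longrightarrow> ?ii"
    by blast
  have ii_iii: ?iii if ?ii
  proof -
    from that obtain y and k :: nat where k: "k > 0"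
      and y: "a ^ Suc k * y * a ^ k = a ^ k" "star (a ^ Suc k * y) = a ^ Suc k * y"
      by auto
    \<comment> \<open>Thus \<open>a * y\<close> serves as a {1,3}-inverse of
      \<open>a ^ k\<close>.\<close>
    have "a ^ k * (a * y) = a ^ Suc k * y"
      by (simp only: power_Suc2 mult.assoc)
    with y have "a ^ k \<in> one_three_invertibles"
      unfolding one_three_invertibles_def by (metis (mono_tags, lifting) mem_Collect_eq)
    \<comment> \<open>The same equation, bracketed differently, puts \<open>a ^ k\<close> in the
      right ideal of \<open>a ^ Suc k\<close>.\<close>
    moreover have "a ^ k = a ^ Suc k * (y * a ^ k)"
      using y(1) by (simp only: mult.assoc)
    ultimately show ?iii
      using k right_multiples_power_Suc_eq_iff [of a k] by (metis Suc_eq_plus1)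
  qed
  have iii_i: "right_pseudo_core_invertible a" if ?iii
    using that is_right_pseudo_core_inverseI right_multiples_power_Suc_eq_iff
    unfolding right_pseudo_core_invertible_def one_three_invertibles_def Suc_eq_plus1 [symmetric]
    by blast
  from i_iv iv_ii ii_iii iii_i show ?thesis
    by argo
qed

end
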